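(* Let $(X,T,m)$ be an ergodic measure-preserving system ($m$ a $T$-invariant ergodic probability measure on $X$), and let $f\colon X\to\mathbb{R}$ be a measurable observable, integrable with $\int f\,dm=0$. Write $S_nf=f+f\circ T+\cdots+f\circ T^{n-1}$, and for $\varepsilon>0$, $n\ge 1$ let \[\Lambda_n^+(\varepsilon)=m\left\{x\in X:\tfrac{S_nf(x)}{n}\ge\varepsilon\right\},\qquad \Lambda_n^-(\varepsilon)=m\left\{x\in X:\tfrac{S_nf(x)}{n}\le-\varepsilon\right\},\] and $\Lambda_n(\varepsilon)=\Lambda_n^+(\varepsilon)+\Lambda_n^-(\varepsilon)$. Suppose that the following two hypotheses hold. (CLT) There exists $0<\sigma<\infty$ such that $\frac{S_nf}{\sigma\sqrt n}$ converges in distribution (with respect to $m$) to the standard normal law $\mathcal N(0,1)$ as $n\to\infty$. (LD) There exist constants $\delta>0$, $M>0$, $C>0$ and a $C^2$ function $I\colon(-\delta,\delta)\to[0,\infty)$ such that $I(0)=0$, $I'(0)=0$, $I''(0)>0$, and such that for any $n\ge1$ and any $\varepsilon\in(0,\delta)$ with $\varepsilon>M/n$, \[\Lambda_n^+(\varepsilon)\le Ce^{-I(\varepsilon)n}\quad\text{and}\quad \Lambda_n^-(\varepsilon)\le Ce^{-I(-\varepsilon)n}.\] Then \[\lim_{\varepsilon\to0}\frac{1}{-\log\varepsilon}\sum_{n=1}^\infty\frac{\Lambda_n(\varepsilon)}{n}=2.\]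
   Context: The parameter $\varepsilon$ is always positive, so $\varepsilon\to0$ means $\varepsilon\to0^+$. *)

theory Defs
  imports "HOL-Probability.Probability"
begin

locale ergodic_system = prob_space m
  for m :: "'a measure" +
  fixes T :: "'a \<Rightarrow> 'a"
  assumes T_measurable: "T \<in> measurable m m"
    and T_preserves: "distr m m T = m"
    and T_ergodic: "\<And>A. A \<in> sets m \<Longrightarrow> T -` A \<inter> space m = A \<Longrightarrow>
      measure m A = 0 \<or> measure m A = 1"

definition birkhoff_sum :: "('a \<Rightarrow> 'a) \<Rightarrow> ('a \<Rightarrow> real) \<Rightarrow> nat \<Rightarrow> 'a \<Rightarrow> real" where
  "birkhoff_sum T f n x = (\<Sum>k<n. f ((T ^^ k) x))"

definition Lambda_plus ::
    "'a measure \<Rightarrow> ('a \<Rightarrow> 'a) \<Rightarrow> ('a \<Rightarrow> real) \<Rightarrow> nat \<Rightarrow> real \<Rightarrow> real" where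
  "Lambda_plus m T f n \<epsilon> = measure m {x \<in> space m. birkhoff_sum T f n x / real n \<ge> \<epsilon>}"

definition Lambda_minus ::
    "'a measure \<Rightarrow> ('a \<Rightarrow> 'a) \<Rightarrow> ('a \<Rightarrow> real) \<Rightarrow> nat \<Rightarrow> real \<Rightarrow> real" where
  "Lambda_minus m T f n \<epsilon> = measure m {x \<in> space m. birkhoff_sum T f n x / real n \<le> - \<epsilon>}"

definition Lambda ::
    "'a measure \<Rightarrow> ('a \<Rightarrow> 'a) \<Rightarrow> ('a \<Rightarrow> real) \<Rightarrow> nat \<Rightarrow> real \<Rightarrow> real" where
  "Lambda m T f n \<epsilon> = Lambda_plus m T f n \<epsilon> + Lambda_minus m T f n \<epsilon>"

(* Intended for open S, where deriv depends only on the values of f on S. *)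
definition C2_on :: "real set \<Rightarrow> (real \<Rightarrow> real) \<Rightarrow> bool" where
  "C2_on S f \<longleftrightarrow> f differentiable_on S \<and> deriv f differentiable_on S \<and>
    continuous_on S (deriv (deriv f))"

end

theory Submission
  imports Defs
begin

text \<open>
  Only two ranges of \<open>n\<close> matter. For \<open>n \<le> 1/\<epsilon>\<^sup>2\<close> the bound \<open>\<Lambda>\<^sub>n \<le> 1\<close> contributes a harmonic sum,
  that is \<open>2 ln (1/\<epsilon>) + O(1)\<close>; for \<open>n > 1/\<epsilon>\<^sup>2\<close> (which eventually implies \<open>\<epsilon> > M/n\<close>) the quadratic
  minimum of the rate function gives a geometric tail \<open>B exp (- c \<epsilon>\<^sup>2 n)\<close>, whose contribution is \<open>O(1)\<close>.
  Conversely, as the normal law has no atom at 0, the central limit theorem gives for each \<open>\<eta> > 0\<close> some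
  \<open>b > 0\<close> such that \<open>\<bar>S\<^sub>n\<bar> \<ge> b \<surd>n\<close> with probability at least \<open>1 - \<eta>\<close> for large \<open>n\<close>; hence
  \<open>\<Lambda>\<^sub>n(\<epsilon>) \<ge> 1 - \<eta>\<close> for all large \<open>n \<le> (b/\<epsilon>)\<^sup>2\<close>.
\<close>

section \<open>Quadratic lower bound for the rate function near 0\<close>

text \<open>Because \<open>f' x / x\<close> tends to \<open>d\<close> at 0, the slope
  \<open>f' x\<close> lies above \<open>d / 2 * x\<close> just to the right of 0 and below it just
  to the left. So \<open>f x - d / 4 * x\<^sup>2\<close> decreases up to 0 and increases
  afterwards.\<close>

lemma quadratic_lower_bound_at_minimum:
  fixes f f' :: "real \<Rightarrow> real"
  assumes "r > 0" and f: "\<And>x. \<bar>x\<bar> < r \<Longrightarrow> (f has_real_derivative f' x) (at x)"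
    and f': "(f' has_real_derivative d) (at 0)"
    and zero: "f 0 = 0" "f' 0 = 0" and "d > 0"
  shows "\<exists>h>0. \<forall>x. \<bar>x\<bar> < h \<longrightarrow> d / 4 * x\<^sup>2 \<le> f x"
proof -
  have "((\<lambda>x. f' x / x) \<longlongrightarrow> d) (at 0)"
    using f' zero by (simp add: has_field_derivative_iff)
  then have "\<forall>\<^sub>F x in at 0. d / 2 < f' x / x"
    using \<open>d > 0\<close> by (intro order_tendstoD) auto
  then obtain s where "s > 0" and s: "\<And>x. x \<noteq> 0 \<Longrightarrow> \<bar>x\<bar> < s \<Longrightarrow> d / 2 < f' x / x"
    by (auto simp: eventually_at dist_real_def)
  define g where "g x = f x - d / 4 * x\<^sup>2" for x
  have g: "(g has_real_derivative (f' x - d / 2 * x)) (at x)" if "\<bar>x\<bar> < r" for x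
    unfolding g_def using f[OF that] by (auto intro!: derivative_eq_intros)
  have pos: "f' x - d / 2 * x \<ge> 0" if "0 \<le> x" "x < s" for x
    using s[of x] that zero by (cases "x = 0") (auto simp: field_simps)
  have neg: "f' x - d / 2 * x \<le> 0" if "x \<le> 0" "- s < x" for x
    using s[of x] that zero by (cases "x = 0") (auto simp: field_simps)
  have "d / 4 * x\<^sup>2 \<le> f x" if x: "\<bar>x\<bar> < min r s" for x
  proof (cases "x \<ge> 0")
    case True
    have "g 0 \<le> g x"
      by (rule DERIV_nonneg_imp_nondecreasing[OF True]) (use g pos x in force)
    then show ?thesis by (simp add: g_def zero)
  next
    case False
    then have "x \<le> 0" by simp
    have "g x \<ge> g 0"
      by (rule DERIV_nonpos_imp_nonincreasing[OF \<open>x \<le> 0\<close>]) (use g neg x in force)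
    then show ?thesis by (simp add: g_def zero)
  qed
  then show ?thesis using \<open>r > 0\<close> \<open>s > 0\<close> by (intro exI[of _ "min r s"]) auto
qed

lemma C2_on_quadratic_lower_bound:
  assumes "\<delta> > 0" "C2_on {-\<delta><..<\<delta>} I"
    and "I 0 = 0" "deriv I 0 = 0" "deriv (deriv I) 0 > 0"
  shows "\<exists>h>0. \<forall>x. \<bar>x\<bar> < h \<longrightarrow> deriv (deriv I) 0 / 4 * x\<^sup>2 \<le> I x"
proof (rule quadratic_lower_bound_at_minimum[of \<delta>])
  \<comment> \<open>The interval is open, so differentiability within it is differentiability at the
    point, and \<open>deriv\<close> is a genuine derivative there.\<close>
  have *: "(F has_real_derivative deriv F x) (at x)"
    if "F differentiable_on {-\<delta><..<\<delta>}" "\<bar>x\<bar> < \<delta>" for F x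
  proof -
    have "F differentiable (at x within {-\<delta><..<\<delta>})"
      using that by (simp add: differentiable_on_def abs_less_iff)
    then have "F differentiable (at x)"
      using that by (simp add: at_within_open[of _ "{-\<delta><..<\<delta>}"] abs_less_iff)
    then show ?thesis by (simp add: DERIV_deriv_iff_real_differentiable)
  qed
  show "(I has_real_derivative deriv I x) (at x)" if "\<bar>x\<bar> < \<delta>" for x
    using * that assms(2) by (simp add: C2_on_def)
  show "(deriv I has_real_derivative deriv (deriv I) 0) (at 0)"
    using * assms(1,2) by (simp add: C2_on_def)
qed (use assms in auto)

section \<open>Series with weights \<open>1 / n\<close>: estimates from above and below\<close>

lemma harm_le_ln_plus_1:
  assumes "n > 0"
  shows "harm n \<le> ln (real n) + 1"
  using euler_mascheroni_sequence_decreasing[of 1 n] assms by (simp add: harm_expand)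

text \<open>Follows from \<open>exp (c * x) \<ge> 1 + c * x\<close>. Used with
  \<open>x = \<epsilon>\<^sup>2\<close>, it bounds the geometric tail uniformly in
  \<open>\<epsilon>\<close>.\<close>

lemma scaled_geometric_series_bound:
  fixes c x :: real
  assumes "c > 0" "0 < x" "x \<le> 1"
  shows "x / (1 - exp (- (c * x))) \<le> (1 + c) / c"
proof -
  have cx: "c * x > 0" using assms by simp
  have "exp (- (c * x)) \<le> 1 / (1 + c * x)"
    using exp_ge_add_one_self[of "c * x"] cx by (simp add: exp_minus divide_simps)
  then have "c * x / (1 + c * x) \<le> 1 - exp (- (c * x))"
    using cx by (simp add: field_simps)
  then have "x / (1 - exp (- (c * x))) \<le> x / (c * x / (1 + c * x))"
    using cx assms by (intro divide_left_mono mult_pos_pos divide_pos_pos add_pos_pos) auto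
  also have "\<dots> = (1 + c * x) / c" using assms by (simp add: field_simps)
  also have "\<dots> \<le> (1 + c) / c" using assms by (intro divide_right_mono) auto
  finally show ?thesis .
qed

text \<open>The terms up to \<open>1 / \<epsilon>\<^sup>2\<close> are dominated by a harmonic sum,
  the later ones by a geometric series; the majorant \<open>u + v\<close> gives both summability and
  the bound.\<close>

lemma harmonic_weighted_sum_upper_bound:
  fixes p :: "nat \<Rightarrow> real"
  assumes \<epsilon>: "0 < \<epsilon>" "\<epsilon> \<le> 1" and "c > 0" "B \<ge> 0"
    and p: "\<And>n. 0 \<le> p n" "\<And>n. p n \<le> 1"
    and tail: "\<And>n. 1 / \<epsilon>\<^sup>2 < real n \<Longrightarrow> p n \<le> B * exp (- (c * \<epsilon>\<^sup>2 * real n))"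
  shows "summable (\<lambda>n. p (Suc n) / real (Suc n))"
    and "(\<Sum>n. p (Suc n) / real (Suc n)) \<le> 2 * (- ln \<epsilon>) + (1 + B * ((1 + c) / c))"
proof -
  define N where "N = nat \<lfloor>1 / \<epsilon>\<^sup>2\<rfloor>"
  define q where "q = exp (- (c * \<epsilon>\<^sup>2))"
  have \<epsilon>2: "0 < \<epsilon>\<^sup>2" "\<epsilon>\<^sup>2 \<le> 1" using \<epsilon> by (auto simp: power_le_one)
  \<comment> \<open>Here \<open>\<epsilon> \<le> 1\<close> enters: it makes \<open>N\<close>
    positive, so that \<open>ln (real N)\<close> can be used below.\<close>
  then have "1 \<le> \<lfloor>1 / \<epsilon>\<^sup>2\<rfloor>" by (simp add: le_floor_iff)
  then have N: "N \<ge> 1" "real N \<le> 1 / \<epsilon>\<^sup>2" "1 / \<epsilon>\<^sup>2 < real N + 1"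
    unfolding N_def by linarith+
  have q: "0 < q" "q < 1" using \<epsilon>2 \<open>c > 0\<close> by (auto simp: q_def)
  \<comment> \<open>Index \<open>n\<close> carries the term of number \<open>Suc n\<close>, so
    \<open>n < N\<close> selects exactly the terms 1 to \<open>N\<close>.\<close>
  define u where "u n = (if n \<in> {..<N} then inverse (real (Suc n)) else 0)" for n
  \<comment> \<open>Past the cut the weight \<open>1 / Suc n\<close> is at most
    \<open>\<epsilon>\<^sup>2\<close>, which gives the factor; \<open>q ^ Suc n\<close> is relaxed
    to \<open>q ^ n\<close>.\<close>
  define v where "v n = B * \<epsilon>\<^sup>2 * q ^ n" for n
  have "u sums (\<Sum>n<N. inverse (real (Suc n)))"
    unfolding u_def by (rule sums_If_finite_set) simp
  then have u: "u sums harm N" by (simp only: harm_altdef)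
  have v: "v sums (B * \<epsilon>\<^sup>2 * (1 / (1 - q)))"
    unfolding v_def using q by (intro sums_mult geometric_sums) simp
  have le: "p (Suc n) / real (Suc n) \<le> u n + v n" for n
  proof (cases "n < N")
    case True
    have "p (Suc n) / real (Suc n) \<le> 1 / real (Suc n)"
      by (intro divide_right_mono p) simp
    moreover have "v n \<ge> 0" using q \<open>B \<ge> 0\<close> by (simp add: v_def)
    ultimately show ?thesis using True by (simp add: u_def inverse_eq_divide)
  next
    case False
    then have large: "1 / \<epsilon>\<^sup>2 < real (Suc n)" using N by simp
    have "exp (- (c * \<epsilon>\<^sup>2 * real (Suc n))) = q ^ Suc n"
      unfolding q_def exp_of_nat_mult[symmetric] by (simp only: mult_ac mult_minus_left mult_minus_right)
    also have "\<dots> \<le> q ^ n" using q by (intro power_decreasing) auto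
    finally have "p (Suc n) \<le> B * q ^ n"
      using tail[OF large] mult_left_mono[OF _ \<open>B \<ge> 0\<close>] by fastforce
    moreover have "1 / real (Suc n) \<le> \<epsilon>\<^sup>2"
      using large \<epsilon>2 by (simp add: field_simps)
    ultimately have "p (Suc n) * (1 / real (Suc n)) \<le> (B * q ^ n) * \<epsilon>\<^sup>2"
      by (intro mult_mono) (use q \<open>B \<ge> 0\<close> in auto)
    then show ?thesis using False by (simp add: u_def v_def mult_ac)
  qed
  have uv: "(\<lambda>n. u n + v n) sums (harm N + B * \<epsilon>\<^sup>2 * (1 / (1 - q)))"
    by (intro sums_add u v)
  show sm: "summable (\<lambda>n. p (Suc n) / real (Suc n))"
  proof (rule summable_comparison_test'[OF sums_summable[OF uv]])
    show "norm (p (Suc n) / real (Suc n)) \<le> u n + v n" for n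
      using le[of n] p(1)[of "Suc n"] by simp
  qed
  have "(\<Sum>n. p (Suc n) / real (Suc n)) \<le> harm N + B * \<epsilon>\<^sup>2 * (1 / (1 - q))"
    using suminf_le[OF le sm sums_summable[OF uv]] sums_unique[OF uv] by simp
  moreover have "harm N \<le> 2 * (- ln \<epsilon>) + 1"
  proof -
    have "ln (real N) \<le> ln (1 / \<epsilon>\<^sup>2)" using N by (intro ln_mono) auto
    also have "\<dots> = 2 * (- ln \<epsilon>)" using \<epsilon> by (simp add: ln_div ln_realpow)
    finally show ?thesis using harm_le_ln_plus_1[of N] N by simp
  qed
  moreover have "B * \<epsilon>\<^sup>2 * (1 / (1 - q)) \<le> B * ((1 + c) / c)"
    using mult_left_mono[OF scaled_geometric_series_bound[OF \<open>c > 0\<close> \<epsilon>2] \<open>B \<ge> 0\<close>]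
    by (simp add: q_def)
  ultimately show "(\<Sum>n. p (Suc n) / real (Suc n)) \<le> 2 * (- ln \<epsilon>) + (1 + B * ((1 + c) / c))"
    by simp
qed

text \<open>With \<open>R\<close> the integer part of \<open>(b / \<epsilon>)\<^sup>2\<close>,
  \<open>harm R\<close> is at least \<open>2 * ln b - 2 * ln \<epsilon>\<close>. Discarding the
  first \<open>N\<close> terms costs at most \<open>harm N\<close>, which does not depend on
  \<open>\<epsilon>\<close>.\<close>

lemma harmonic_weighted_sum_lower_bound:
  fixes p :: "nat \<Rightarrow> real"
  assumes "0 < \<epsilon>" "0 < b" "0 \<le> \<theta>"
    and p: "\<And>n. 0 \<le> p n" and sm: "summable (\<lambda>n. p (Suc n) / real (Suc n))"
    and large: "\<And>n. N \<le> n \<Longrightarrow> 1 \<le> n \<Longrightarrow> real n \<le> (b / \<epsilon>)\<^sup>2 \<Longrightarrow> \<theta> \<le> p n"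
  shows "\<theta> * (2 * (- ln \<epsilon>)) + \<theta> * (2 * ln b - harm N) \<le> (\<Sum>n. p (Suc n) / real (Suc n))"
proof -
  define R where "R = nat \<lfloor>(b / \<epsilon>)\<^sup>2\<rfloor>"
  have pos: "0 < (b / \<epsilon>)\<^sup>2" using assms by simp
  then have "0 \<le> \<lfloor>(b / \<epsilon>)\<^sup>2\<rfloor>" by simp
  then have R: "real R \<le> (b / \<epsilon>)\<^sup>2" "(b / \<epsilon>)\<^sup>2 < real R + 1"
    unfolding R_def by linarith+
  have "2 * (- ln \<epsilon>) + 2 * ln b = ln ((b / \<epsilon>)\<^sup>2)"
    using assms by (simp add: ln_realpow ln_div)
  also have "\<dots> \<le> ln (real R + 1)" using R pos by (intro ln_mono) auto
  also have "\<dots> \<le> harm R" by (rule ln_le_harm)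
  finally have "\<theta> * (2 * (- ln \<epsilon>) + 2 * ln b - harm N) \<le> \<theta> * (harm R - harm N)"
    using assms by (intro mult_left_mono) auto
  also have "\<dots> \<le> \<theta> * (\<Sum>n\<in>{N..<R}. inverse (real (Suc n)))"
  proof (intro mult_left_mono)
    \<comment> \<open>Only an inclusion of index sets is used, which covers the case
      \<open>R < N\<close> as well.\<close>
    have "harm R \<le> (\<Sum>n\<in>{..<N} \<union> {N..<R}. inverse (real (Suc n)))"
      unfolding harm_altdef by (intro sum_mono2) auto
    also have "\<dots> = harm N + (\<Sum>n\<in>{N..<R}. inverse (real (Suc n)))"
      unfolding harm_altdef by (intro sum.union_disjoint) auto
    finally show "harm R - harm N \<le> (\<Sum>n\<in>{N..<R}. inverse (real (Suc n)))" by simp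
  qed (use assms in auto)
  also have "\<dots> = (\<Sum>n\<in>{N..<R}. \<theta> / real (Suc n))"
    by (simp only: sum_distrib_left divide_inverse)
  also have "\<dots> \<le> (\<Sum>n\<in>{N..<R}. p (Suc n) / real (Suc n))"
  proof (intro sum_mono divide_right_mono large)
    fix n assume "n \<in> {N..<R}"
    then have "real (Suc n) \<le> real R" by simp
    then show "real (Suc n) \<le> (b / \<epsilon>)\<^sup>2" using R by linarith
  qed auto
  also have "\<dots> \<le> (\<Sum>n. p (Suc n) / real (Suc n))"
    by (intro sum_le_suminf sm) (auto simp: p)
  finally show ?thesis by (simp add: algebra_simps)
qed

section \<open>Anti-concentration from the central limit theorem\<close>

text \<open>The normal distribution function is continuous, so some interval around 0 has normal
  mass below \<open>\<eta>\<close>. Its endpoints are continuity points, hence weak convergence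
  carries the strict bound over to \<open>Y n\<close> for large \<open>n\<close>.\<close>

lemma (in prob_space) weak_conv_m_std_normal_abs_ge:
  fixes Y :: "nat \<Rightarrow> 'a \<Rightarrow> real"
  assumes Y [measurable]: "\<And>n. Y n \<in> borel_measurable M"
    and conv: "weak_conv_m (\<lambda>n. distr M borel (Y n)) std_normal_distribution"
    and "0 < \<eta>"
  shows "\<exists>a>0. \<exists>N. \<forall>n\<ge>N. 1 - \<eta> \<le> prob {x \<in> space M. a \<le> \<bar>Y n x\<bar>}"
proof -
  interpret Z: real_distribution std_normal_distribution by (rule real_dist_normal_dist)
  let ?\<Phi> = "cdf std_normal_distribution"
  have cont: "isCont ?\<Phi> x" for x
  proof -
    have "emeasure std_normal_distribution {x} = 0"
      by (subst emeasure_density) (auto simp: nn_integral_0_iff_AE intro!: AE_I'[of "{x}"])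
    then show ?thesis by (simp add: Z.isCont_cdf measure_def)
  qed
  have "(\<lambda>a. ?\<Phi> a - ?\<Phi> (- a)) \<midarrow>0\<rightarrow> ?\<Phi> 0 - ?\<Phi> (- 0)"
    by (intro tendsto_diff isCont_tendsto_compose[OF cont] tendsto_intros)
  then have "\<forall>\<^sub>F a in at 0. ?\<Phi> a - ?\<Phi> (- a) < \<eta>"
    using \<open>0 < \<eta>\<close> by (intro order_tendstoD) auto
  then obtain d where "d > 0" and d: "\<And>a. a \<noteq> 0 \<Longrightarrow> \<bar>a\<bar> < d \<Longrightarrow> ?\<Phi> a - ?\<Phi> (- a) < \<eta>"
    by (auto simp: eventually_at dist_real_def)
  define a where "a = d / 2"
  have a: "a > 0" "?\<Phi> a - ?\<Phi> (- a) < \<eta>" using \<open>d > 0\<close> d[of a] by (auto simp: a_def)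
  let ?F = "\<lambda>n. cdf (distr M borel (Y n))"
  have "(\<lambda>n. ?F n a - ?F n (- a)) \<longlonglongrightarrow> ?\<Phi> a - ?\<Phi> (- a)"
    using conv cont by (intro tendsto_diff) (auto simp: weak_conv_m_def weak_conv_def)
  then have "\<forall>\<^sub>F n in sequentially. ?F n a - ?F n (- a) < \<eta>"
    using a(2) by (rule order_tendstoD)
  then obtain N where N: "\<And>n. n \<ge> N \<Longrightarrow> ?F n a - ?F n (- a) < \<eta>"
    by (auto simp: eventually_sequentially)
  have "1 - \<eta> \<le> prob {x \<in> space M. a \<le> \<bar>Y n x\<bar>}" if "n \<ge> N" for n
  proof -
    interpret D: prob_space "distr M borel (Y n)" by (rule prob_space_distr) (rule Y)
    interpret D: real_distribution "distr M borel (Y n)" by unfold_locales auto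
    have "1 - prob {x \<in> space M. a \<le> \<bar>Y n x\<bar>}
        = prob (space M - {x \<in> space M. a \<le> \<bar>Y n x\<bar>})"
      by (subst prob_compl) auto
    \<comment> \<open>The complement is the event \<open>\<bar>Y n x\<bar> < a\<close>; adding the
      right endpoint makes the interval half-open, so that its mass is a difference of distribution
      function values.\<close>
    also have "\<dots> \<le> prob (Y n -` {- a<..a} \<inter> space M)"
      by (intro finite_measure_mono) auto
    also have "\<dots> = ?F n a - ?F n (- a)"
      using a(1) by (subst D.cdf_diff_eq) (auto simp: measure_distr)
    finally show ?thesis using N[OF that] by simp
  qed
  then show ?thesis using a(1) by blast
qed

section \<open>Passage to the limit\<close>

text \<open>Bounded errors vanish after division by \<open>- ln \<epsilon>\<close>. The constant in
  \<open>lower\<close> may depend on \<open>\<eta>\<close>, since \<open>\<eta>\<close> is fixed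
  before \<open>\<epsilon>\<close> tends to 0.\<close>

lemma tendsto_log_ratio:
  fixes S :: "real \<Rightarrow> real"
  assumes upper: "\<forall>\<^sub>F \<epsilon> in at_right 0. S \<epsilon> \<le> 2 * (- ln \<epsilon>) + K"
    and lower: "\<And>\<eta>. 0 < \<eta> \<Longrightarrow> \<eta> < 1 \<Longrightarrow>
      \<exists>K. \<forall>\<^sub>F \<epsilon> in at_right 0. (1 - \<eta>) * (2 * (- ln \<epsilon>)) + K \<le> S \<epsilon>"
  shows "((\<lambda>\<epsilon>. 1 / (- ln \<epsilon>) * S \<epsilon>) \<longlongrightarrow> 2) (at_right 0)"
proof -
  have L: "filterlim (\<lambda>\<epsilon>::real. - ln \<epsilon>) at_top (at_right 0)"
    using ln_at_0 by (simp add: filterlim_uminus_at_bot)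
  have lim: "((\<lambda>\<epsilon>. t + k / (- ln \<epsilon>)) \<longlongrightarrow> t) (at_right 0)" for t k :: real
    using tendsto_add[OF tendsto_const tendsto_divide_0[OF tendsto_const
        filterlim_at_top_imp_at_infinity[OF L]], of t k] by simp
  have pos: "\<forall>\<^sub>F \<epsilon> in at_right 0. 0 < - ln (\<epsilon>::real)"
    using filterlim_at_top_dense[THEN iffD1, OF L] by (rule spec)
  show ?thesis
  proof (rule order_tendstoI)
    fix l :: real assume "l > 2"
    then have "\<forall>\<^sub>F \<epsilon> in at_right 0. 2 + K / (- ln \<epsilon>) < l"
      by (rule order_tendstoD(2)[OF lim])
    then show "\<forall>\<^sub>F \<epsilon> in at_right 0. 1 / (- ln \<epsilon>) * S \<epsilon> < l"
      using upper pos
    proof eventually_elim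
      case (elim \<epsilon>)
      have "1 / (- ln \<epsilon>) * S \<epsilon> \<le> 1 / (- ln \<epsilon>) * (2 * (- ln \<epsilon>) + K)"
        using elim by (intro mult_left_mono) auto
      also have "\<dots> = 2 + K / (- ln \<epsilon>)" using elim by (simp add: field_simps)
      finally show ?case using elim by simp
    qed
  next
    fix l :: real assume "l < 2"
    \<comment> \<open>The second entry gives \<open>2 * \<eta> \<le> (2 - l) / 2 < 2 - l\<close>;
      the cap \<open>1 / 2\<close> keeps \<open>\<eta>\<close> below 1.\<close>
    define \<eta> where "\<eta> = min (1 / 2) ((2 - l) / 4)"
    have \<eta>: "0 < \<eta>" "\<eta> < 1" "l < (1 - \<eta>) * 2" using \<open>l < 2\<close> by (auto simp: \<eta>_def min_def field_simps)
    obtain k where k: "\<forall>\<^sub>F \<epsilon> in at_right 0. (1 - \<eta>) * (2 * (- ln \<epsilon>)) + k \<le> S \<epsilon>"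
      using lower \<eta> by blast
    have "\<forall>\<^sub>F \<epsilon> in at_right 0. l < (1 - \<eta>) * 2 + k / (- ln \<epsilon>)"
      using \<eta>(3) by (rule order_tendstoD(1)[OF lim])
    then show "\<forall>\<^sub>F \<epsilon> in at_right 0. l < 1 / (- ln \<epsilon>) * S \<epsilon>"
      using k pos
    proof eventually_elim
      case (elim \<epsilon>)
      have "(1 - \<eta>) * 2 + k / (- ln \<epsilon>) = 1 / (- ln \<epsilon>) * ((1 - \<eta>) * (2 * (- ln \<epsilon>)) + k)"
        using elim by (simp add: field_simps)
      also have "\<dots> \<le> 1 / (- ln \<epsilon>) * S \<epsilon>"
        using elim by (intro mult_left_mono) auto
      finally show ?case using elim by simp
    qed
  qed
qed

section \<open>Deviations of Birkhoff averages\<close>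

lemma birkhoff_sum_measurable:
  assumes [measurable]: "T \<in> measurable m m" "f \<in> borel_measurable m"
  shows "birkhoff_sum T f n \<in> borel_measurable m"
  unfolding birkhoff_sum_def by measurable

text \<open>For positive \<open>\<epsilon>\<close> the two tail events are disjoint. Being a single
  probability, \<open>Lambda\<close> is at most 1 and can be compared with events on absolute
  values.\<close>

lemma (in prob_space) Lambda_eq_prob_abs:
  assumes [measurable]: "T \<in> measurable M M" "f \<in> borel_measurable M" and "0 < \<epsilon>"
  shows "Lambda M T f n \<epsilon> = prob {x \<in> space M. \<epsilon> \<le> \<bar>birkhoff_sum T f n x / real n\<bar>}"
proof -
  note birkhoff_sum_measurable[OF assms(1,2), measurable]
  have "Lambda M T f n \<epsilon> = prob ({x \<in> space M. birkhoff_sum T f n x / real n \<ge> \<epsilon>} \<union>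
      {x \<in> space M. birkhoff_sum T f n x / real n \<le> - \<epsilon>})"
    unfolding Lambda_def Lambda_plus_def Lambda_minus_def
    using \<open>0 < \<epsilon>\<close> by (subst finite_measure_Union) auto
  then show ?thesis
    by (rule trans) (auto simp only: abs_if intro!: arg_cong[where f = prob] split: if_splits)
qed

text \<open>Summability is asserted separately because the value of \<open>suminf\<close> is
  informative only for a convergent series; the shift to \<open>Suc n\<close> starts the sum at
  1.\<close>

theorem theorem1p4:
  fixes m :: "'a measure" and T :: "'a \<Rightarrow> 'a" and f :: "'a \<Rightarrow> real"
  assumes "ergodic_system m T"
    and "f \<in> borel_measurable m"
    and "integrable m f"
    and "integral\<^sup>L m f = 0"
    and CLT: "\<exists>\<sigma>::real. \<sigma> > 0 \<and>
      weak_conv_m (\<lambda>n. distr m borel (\<lambda>x. birkhoff_sum T f n x / (\<sigma> * sqrt (real n))))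
        std_normal_distribution"
    and LD: "\<exists>(\<delta>::real) (M::real) (C::real) (I::real \<Rightarrow> real).
      \<delta> > 0 \<and> M > 0 \<and> C > 0 \<and>
      C2_on {-\<delta><..<\<delta>} I \<and> (\<forall>t\<in>{-\<delta><..<\<delta>}. I t \<ge> 0) \<and>
      I 0 = 0 \<and> deriv I 0 = 0 \<and> deriv (deriv I) 0 > 0 \<and>
      (\<forall>n\<ge>1. \<forall>\<epsilon>\<in>{0<..<\<delta>}. \<epsilon> > M / real n \<longrightarrow>
        Lambda_plus m T f n \<epsilon> \<le> C * exp (- I \<epsilon> * real n) \<and>
        Lambda_minus m T f n \<epsilon> \<le> C * exp (- I (- \<epsilon>) * real n))"
  shows "(\<forall>\<^sub>F \<epsilon> in at_right 0. summable (\<lambda>n. Lambda m T f (Suc n) \<epsilon> / real (Suc n))) \<and>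
    ((\<lambda>\<epsilon>. 1 / (- ln \<epsilon>) * (\<Sum>n. Lambda m T f (Suc n) \<epsilon> / real (Suc n))) \<longlongrightarrow> 2) (at_right 0)"
proof -
  interpret ergodic_system m T by fact
  note T_measurable[measurable] assms(2)[measurable]
  note birkhoff_sum_measurable[OF T_measurable assms(2), measurable]
  let ?L = "Lambda m T f"
  let ?S = "\<lambda>\<epsilon>. \<Sum>n. ?L (Suc n) \<epsilon> / real (Suc n)"
  note L_eq = Lambda_eq_prob_abs[OF T_measurable assms(2)]
  have p: "0 \<le> ?L n \<epsilon>" "?L n \<epsilon> \<le> 1" if "0 < \<epsilon>" for n \<epsilon>
    using that by (auto simp: L_eq)
  obtain \<delta> M C I where "\<delta> > 0" "M > 0" "C > 0" and I: "C2_on {-\<delta><..<\<delta>} I" "I 0 = 0"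
      "deriv I 0 = 0" "deriv (deriv I) 0 > 0"
    and ld: "\<And>n \<epsilon>. n \<ge> 1 \<Longrightarrow> 0 < \<epsilon> \<Longrightarrow> \<epsilon> < \<delta> \<Longrightarrow> \<epsilon> > M / real n \<Longrightarrow>
        Lambda_plus m T f n \<epsilon> \<le> C * exp (- I \<epsilon> * real n) \<and>
        Lambda_minus m T f n \<epsilon> \<le> C * exp (- I (- \<epsilon>) * real n)"
    using LD by (metis greaterThanLessThan_iff)
  define c where "c = deriv (deriv I) 0 / 4"
  have "c > 0" using I by (simp add: c_def)
  obtain h where "h > 0" and h: "\<And>x. \<bar>x\<bar> < h \<Longrightarrow> c * x\<^sup>2 \<le> I x"
    using C2_on_quadratic_lower_bound[OF \<open>\<delta> > 0\<close> I] by (auto simp: c_def)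
  \<comment> \<open>From \<open>n > 1 / \<epsilon>\<^sup>2\<close> and
    \<open>\<epsilon> < 1 / M\<close> one gets \<open>\<epsilon> * n > 1 / \<epsilon> > M\<close>,
    so the large deviation bound applies. The factor 2 counts the two tails.\<close>
  have tail: "?L n \<epsilon> \<le> 2 * C * exp (- (c * \<epsilon>\<^sup>2 * real n))"
    if \<epsilon>: "0 < \<epsilon>" "\<epsilon> < \<delta>" "\<epsilon> < h" "\<epsilon> < 1 / M" and n: "1 / \<epsilon>\<^sup>2 < real n" for n \<epsilon>
  proof -
    have "real n > 0" using n \<epsilon> by (meson less_trans zero_less_divide_1_iff zero_less_power)
    have "M < 1 / \<epsilon>" using \<epsilon> \<open>M > 0\<close> by (simp add: field_simps)
    also have "1 / \<epsilon> < \<epsilon> * real n" using n \<epsilon> by (simp add: field_simps power2_eq_square)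
    finally have "\<epsilon> > M / real n" using \<open>real n > 0\<close> by (simp add: field_simps)
    then have *: "Lambda_plus m T f n \<epsilon> \<le> C * exp (- I \<epsilon> * real n)"
        "Lambda_minus m T f n \<epsilon> \<le> C * exp (- I (- \<epsilon>) * real n)"
      using ld[of n \<epsilon>] \<epsilon> \<open>real n > 0\<close> by auto
    have "C * exp (- I x * real n) \<le> C * exp (- (c * \<epsilon>\<^sup>2 * real n))" if "x = \<epsilon> \<or> x = - \<epsilon>" for x
    proof -
      have "c * \<epsilon>\<^sup>2 \<le> I x" using h[of x] that \<epsilon> by auto
      then show ?thesis using \<open>C > 0\<close> \<open>real n > 0\<close> by (simp add: mult_right_mono)
    qed
    from this[of \<epsilon>] this[of "- \<epsilon>"] * show ?thesis by (simp add: Lambda_def)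
  qed
  have small: "\<forall>\<^sub>F \<epsilon> in at_right 0. 0 < \<epsilon> \<and> \<epsilon> < Min {1, \<delta>, h, 1 / M}"
    using \<open>\<delta> > 0\<close> \<open>h > 0\<close> \<open>M > 0\<close>
    by (intro eventually_at_rightI[of 0 "Min {1, \<delta>, h, 1 / M}"]) auto
  have upper: "\<forall>\<^sub>F \<epsilon> in at_right 0. summable (\<lambda>n. ?L (Suc n) \<epsilon> / real (Suc n)) \<and>
      ?S \<epsilon> \<le> 2 * (- ln \<epsilon>) + (1 + 2 * C * ((1 + c) / c))"
    using small
  proof eventually_elim
    case (elim \<epsilon>)
    then have \<epsilon>: "0 < \<epsilon>" "\<epsilon> \<le> 1" "\<epsilon> < \<delta>" "\<epsilon> < h" "\<epsilon> < 1 / M" by auto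
    show ?case
      using harmonic_weighted_sum_upper_bound[of \<epsilon> c "2 * C" "\<lambda>n. ?L n \<epsilon>"] \<epsilon> p tail
        \<open>c > 0\<close> \<open>C > 0\<close> by auto
  qed
  obtain \<sigma> :: real where "\<sigma> > 0" and
    conv: "weak_conv_m (\<lambda>n. distr m borel (\<lambda>x. birkhoff_sum T f n x / (\<sigma> * sqrt (real n))))
      std_normal_distribution"
    using CLT by blast
  have lower: "\<exists>K. \<forall>\<^sub>F \<epsilon> in at_right 0. (1 - \<eta>) * (2 * (- ln \<epsilon>)) + K \<le> ?S \<epsilon>"
    if \<eta>: "0 < \<eta>" "\<eta> < 1" for \<eta>
  proof -
    have "\<exists>a>0. \<exists>N. \<forall>n\<ge>N. 1 - \<eta> \<le>
        prob {x \<in> space m. a \<le> \<bar>birkhoff_sum T f n x / (\<sigma> * sqrt (real n))\<bar>}"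
      by (rule weak_conv_m_std_normal_abs_ge[OF _ conv \<eta>(1)]) measurable
    then obtain a N where "a > 0" and
      N: "\<And>n. n \<ge> N \<Longrightarrow> 1 - \<eta> \<le>
        prob {x \<in> space m. a \<le> \<bar>birkhoff_sum T f n x / (\<sigma> * sqrt (real n))\<bar>}"
      by blast
    \<comment> \<open>The central limit scale gives
      \<open>\<bar>S\<bar> \<ge> a * \<sigma> * sqrt n\<close> for the Birkhoff sum
      \<open>S\<close>, and this is at least \<open>\<epsilon> * n\<close> as long as
      \<open>sqrt n \<le> a * \<sigma> / \<epsilon>\<close>. So \<open>a * \<sigma>\<close> serves
      as the \<open>b\<close> of the lower bound lemma.\<close>
    have large: "1 - \<eta> \<le> ?L n \<epsilon>"
      if n: "N \<le> n" "1 \<le> n" "real n \<le> (a * \<sigma> / \<epsilon>)\<^sup>2" and "0 < \<epsilon>" for n \<epsilon>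
    proof -
      have "sqrt (real n) \<le> a * \<sigma> / \<epsilon>"
        using n(3) \<open>a > 0\<close> \<open>\<sigma> > 0\<close> \<open>0 < \<epsilon>\<close> by (intro real_le_lsqrt) auto
      then have s: "\<epsilon> * sqrt (real n) \<le> a * \<sigma>" using \<open>0 < \<epsilon>\<close> by (simp add: field_simps)
      have sq: "sqrt (real n) > 0" "real n = sqrt (real n) * sqrt (real n)" using n by auto
      have "\<epsilon> \<le> \<bar>y / real n\<bar>" if "a \<le> \<bar>y / (\<sigma> * sqrt (real n))\<bar>" for y
      proof -
        have "\<epsilon> * real n = (\<epsilon> * sqrt (real n)) * sqrt (real n)"
          using sq(2) by (simp only: mult.assoc flip: sq(2))
        also have "\<dots> \<le> a * \<sigma> * sqrt (real n)" using s sq by (intro mult_right_mono) auto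
        also have "\<dots> \<le> \<bar>y\<bar>"
          using that \<open>\<sigma> > 0\<close> sq(1) by (simp add: abs_mult field_simps)
        finally show ?thesis using n by (simp add: field_simps)
      qed
      then have "prob {x \<in> space m. a \<le> \<bar>birkhoff_sum T f n x / (\<sigma> * sqrt (real n))\<bar>} \<le> ?L n \<epsilon>"
        unfolding L_eq[OF \<open>0 < \<epsilon>\<close>] by (intro finite_measure_mono) auto
      then show ?thesis using N[OF n(1)] by simp
    qed
    have "\<forall>\<^sub>F \<epsilon> in at_right 0.
        (1 - \<eta>) * (2 * (- ln \<epsilon>)) + (1 - \<eta>) * (2 * ln (a * \<sigma>) - harm N) \<le> ?S \<epsilon>"
      using small upper
    proof eventually_elim
      case (elim \<epsilon>)
      then have "0 < \<epsilon>" by simp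
      then show ?case
        using elim \<open>a > 0\<close> \<open>\<sigma> > 0\<close> \<eta>
        by (intro harmonic_weighted_sum_lower_bound p large) auto
    qed
    then show ?thesis by blast
  qed
  have "((\<lambda>\<epsilon>. 1 / (- ln \<epsilon>) * ?S \<epsilon>) \<longlongrightarrow> 2) (at_right 0)"
    by (rule tendsto_log_ratio[OF eventually_mono[OF upper] lower]) auto
  moreover have "\<forall>\<^sub>F \<epsilon> in at_right 0. summable (\<lambda>n. ?L (Suc n) \<epsilon> / real (Suc n))"
    using upper by (rule eventually_mono) simp
  ultimately show ?thesis by simp
qed

end
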